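(* If $\kappa$ is a regular cardinal and $X\subseteq\kappa$ is a stationary set, then $\operatorname{ps}(X)=\operatorname{sm}(X)=\kappa$, where $X$ carries the subspace topology inherited from the order topology of $\kappa$.
   Context: Games ($X$ a topological space, $Y\subseteq X$, $\beta$ an ordinal): two players, Seeker and Hider, make $\beta$ moves. At move $\alpha<\beta$, knowing all previous moves, the Seeker chooses an open set $U_\alpha\subseteq X$, and then the Hider chooses $V_\alpha\in\{U_\alpha, X\setminus U_\alpha\}$. The outcome is $W=\bigcap_{\alpha<\beta}V_\alpha$ (with $W=X$ if $\beta=0$). In the point separating game $G_\beta(X)$ the Seeker wins iff $|W|\le 1$. In the set membership game $G_\beta(Y,X)$ the Seeker wins iff $W\subseteq Y$ or $W\cap Y=\emptyset$. For a $T_0$ space $X$: $\operatorname{ps}(X)$ is the least ordinal $\beta$ such that the Seeker has a winning strategy in $G_\beta(X)$; $\operatorname{sm}(Y,X)$ is the least ordinal $\beta$ such that the Seeker has a winning strategy in $G_\beta(Y,X)$; $\operatorname{sm}(X)=\sup\{\operatorname{sm}(Y,X):Y\subseteq X\}$.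
   Formalization: The regular cardinal κ is assumed uncountable, as is customary for stationary sets; for κ = ω the stationary sets are the cofinite ones, which are discrete, so sm(X) = 1 and the claim fails. *)

theory Defs
  imports "HOL-Analysis.Analysis"
begin

unbundle cardinal_syntax

text \<open>
  An ordinal is represented by a well-order relation \<open>r\<close>; it stands for the order type of \<open>r\<close>, so
  equality and comparison of ordinals are \<open>=o\<close> and \<open>\<le>o\<close>. The moves of a game of length \<open>r\<close> are
  indexed by \<open>Field r\<close>, and the moves before move \<open>a\<close> by \<open>underS r a\<close>.

  A strategy of the Seeker maps a move \<open>a\<close> and a position (all sets chosen by the Seeker and by the
  Hider at earlier moves) to an open set. The history is passed through \<open>restrict\<close>, so the strategy
  has no access to present or future moves.

  \<open>seeker_wins r X P\<close>: the Seeker has a winning strategy in the game of length \<open>r\<close> on \<open>X\<close> whose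
  outcome \<open>W\<close> counts as a win for the Seeker iff \<open>P W\<close>. Intersecting with \<open>topspace X\<close> only matters
  when there are no moves.
\<close>

definition seeker_wins :: "'b rel \<Rightarrow> 'a topology \<Rightarrow> ('a set \<Rightarrow> bool) \<Rightarrow> bool" where
  "seeker_wins r X P \<longleftrightarrow>
    (\<exists>\<sigma> :: 'b \<Rightarrow> ('b \<Rightarrow> 'a set) \<Rightarrow> ('b \<Rightarrow> 'a set) \<Rightarrow> 'a set.
      (\<forall>a\<in>Field r. \<forall>u v. openin X (\<sigma> a u v)) \<and>
      (\<forall>U V. (\<forall>a\<in>Field r. U a = \<sigma> a (restrict U (underS r a)) (restrict V (underS r a)) \<and>
                            V a \<in> {U a, topspace X - U a})
             \<longrightarrow> P (topspace X \<inter> (\<Inter>a\<in>Field r. V a))))"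

definition wins_point_separating :: "'b rel \<Rightarrow> 'a topology \<Rightarrow> bool" where
  "wins_point_separating r X \<longleftrightarrow> seeker_wins r X (\<lambda>W. finite W \<and> card W \<le> 1)"

definition wins_set_membership :: "'b rel \<Rightarrow> 'a set \<Rightarrow> 'a topology \<Rightarrow> bool" where
  "wins_set_membership r Y X \<longleftrightarrow> seeker_wins r X (\<lambda>W. W \<subseteq> Y \<or> W \<inter> Y = {})"

text \<open>
  The least ordinal satisfying \<open>P\<close>, as a choice of representative of its order type (in the same way
  as \<open>card_of\<close> chooses one for a cardinality); it is meaningful if some well-order on a subset of
  \<open>'a\<close> satisfies \<open>P\<close>. Any ordinal below a well-order on a subset of \<open>'a\<close> is again represented there,
  so nothing smaller is missed by not considering other types.
\<close>

definition least_ordinal :: "('a rel \<Rightarrow> bool) \<Rightarrow> 'a rel" where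
  "least_ordinal P = (SOME r. Well_order r \<and> P r \<and> (\<forall>s. Well_order s \<and> P s \<longrightarrow> r \<le>o s))"

lemma least_ordinal:
  assumes "Well_order r" "P r"
  shows "Well_order (least_ordinal P)" "P (least_ordinal P)"
    and "\<And>s. Well_order s \<Longrightarrow> P s \<Longrightarrow> least_ordinal P \<le>o s"
proof -
  obtain m where m: "m \<in> {r. Well_order r \<and> P r}"
    and min: "\<And>s. (s, m) \<in> ordLess \<Longrightarrow> s \<notin> {r. Well_order r \<and> P r}"
    using wfE_min[OF wf_ordLess, of r "{r. Well_order r \<and> P r}"] assms by blast
  have "\<exists>r. Well_order r \<and> P r \<and> (\<forall>s. Well_order s \<and> P s \<longrightarrow> r \<le>o s)"
    using m min by (intro exI[of _ m]) (auto simp flip: not_ordLess_iff_ordLeq)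
  from someI_ex[OF this] show "Well_order (least_ordinal P)" "P (least_ordinal P)"
    and "\<And>s. Well_order s \<Longrightarrow> P s \<Longrightarrow> least_ordinal P \<le>o s"
    unfolding least_ordinal_def by blast+
qed

text \<open>
  On a \<open>T\<^sub>0\<close> space the Seeker wins either game by running through the pairs of points, hence
  (\<open>|X \<times> X| =o |X|\<close> for infinite \<open>X\<close>, and at most \<open>|X|\<close> adaptively chosen moves for finite \<open>X\<close>)
  in a game of length \<open>|X|\<close>. So well-orders on the type of points suffice for the values of all three
  invariants. The last one is the supremum, that is, the least upper bound.
\<close>

definition ps :: "'a topology \<Rightarrow> 'a rel" where
  "ps X = least_ordinal (\<lambda>r. wins_point_separating r X)"

definition sm_set :: "'a set \<Rightarrow> 'a topology \<Rightarrow> 'a rel" where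
  "sm_set Y X = least_ordinal (\<lambda>r. wins_set_membership r Y X)"

definition sm :: "'a topology \<Rightarrow> 'a rel" where
  "sm X = least_ordinal (\<lambda>r. \<forall>Y \<subseteq> topspace X. sm_set Y X \<le>o r)"

text \<open>
  Stationarity in the ordinal that is the order type of \<open>'a\<close>; \<open>closed\<close> refers to the order topology.
\<close>

definition club :: "'a::{wellorder,linorder_topology} set \<Rightarrow> bool" where
  "club C \<longleftrightarrow> closed C \<and> (\<forall>a. \<exists>c\<in>C. a \<le> c)"

definition stationary :: "'a::{wellorder,linorder_topology} set \<Rightarrow> bool" where
  "stationary S \<longleftrightarrow> (\<forall>C. club C \<longrightarrow> S \<inter> C \<noteq> {})"

end

theory Submission
  imports Defs
begin

text \<open>
  The Seeker wins both games in \<open>\<kappa>\<close> moves by playing the rays above the points. In a shorter game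
  the Hider keeps every choice large: by Fodor's lemma a relatively open set that is stationary
  contains a tail of \<open>X\<close>, and the complement of a nonstationary one contains the trace of a club on
  \<open>X\<close>. Fewer than \<open>\<kappa>\<close> clubs have a club intersection, so the outcome contains the trace of a club;
  it has two points, and it meets both halves of a splitting of \<open>X\<close> into two stationary sets.

  Clubs enter only through the sets of closure points of functions, which are cofinal among them.
\<close>

section \<open>Closure points of functions\<close>

definition closure_points :: "('a::wellorder \<Rightarrow> 'a) \<Rightarrow> 'a set" where
  "closure_points F = {s. (\<exists>x. x < s) \<and> (\<forall>x<s. F x < s)}"

lemma closure_pointsD:
  assumes "s \<in> closure_points F" "x < s"
  shows "F x < s"
  using assms by (auto simp: closure_points_def)

lemma closure_points_max:
  "closure_points (\<lambda>x. max (F x) (G x)) = closure_points F \<inter> closure_points G"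
  by (auto simp: closure_points_def)

lemma closure_points_const [simp]: "closure_points (\<lambda>_. a) = {a<..}"
  by (auto simp: closure_points_def)

lemma closed_limit_point:
  fixes C :: "'a::{wellorder,linorder_topology} set"
  assumes "closed C" "x < s" and lim: "\<And>x. x < s \<Longrightarrow> \<exists>c\<in>C. x < c \<and> c \<le> s"
  shows "s \<in> C"
proof (rule ccontr)
  assume "s \<notin> C"
  then obtain b where "b < s" "{b<..s} \<subseteq> - C"
    using open_left[of "- C" s x] assms by (auto simp: closed_def)
  with lim show False by fastforce
qed

lemma seeker_wins_mono:
  assumes "seeker_wins r X P" and PQ: "\<And>W. P W \<Longrightarrow> Q W"
  shows "seeker_wins r X Q"
proof -
  obtain \<sigma> where \<sigma>: "\<forall>a\<in>Field r. \<forall>u v. openin X (\<sigma> a u v)"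
    "\<forall>U V. (\<forall>a\<in>Field r. U a = \<sigma> a (restrict U (underS r a)) (restrict V (underS r a)) \<and>
      V a \<in> {U a, topspace X - U a}) \<longrightarrow> P (topspace X \<inter> (\<Inter>a\<in>Field r. V a))"
    using assms(1) unfolding seeker_wins_def by (elim exE conjE) (rule that)
  show ?thesis
    unfolding seeker_wins_def
  proof (intro exI[of _ \<sigma>] conjI allI impI)
    show "\<forall>a\<in>Field r. \<forall>u v. openin X (\<sigma> a u v)" by (rule \<sigma>(1))
  qed (rule PQ, rule \<sigma>(2)[THEN spec, THEN spec, THEN mp])
qed

section \<open>Bounds from regularity and uncountability\<close>

locale regular_uncountable =
  fixes \<kappa> :: "'a::{wellorder,linorder_topology} rel"
  assumes kappa_eq: "\<kappa> = {(x, y). x \<le> y}"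
    and card: "card_order \<kappa>" and regular: "regularCard \<kappa>"
    and unc: "uncountable (UNIV :: 'a set)"
begin

lemma Field_kappa [simp]: "Field \<kappa> = UNIV"
  by (auto simp: kappa_eq Field_def)

lemma Card_order_kappa: "Card_order \<kappa>"
  using card by simp

lemma Well_order_kappa: "Well_order \<kappa>"
  using card by (simp add: card_order_on_def)

lemma ex_greater: "\<exists>y::'a. x < y"
proof -
  have "infinite (UNIV :: 'a set)" using unc by (auto dest: countable_finite)
  then obtain b where "x \<noteq> b" "(x, b) \<in> \<kappa>"
    using infinite_Card_order_limit[OF Card_order_kappa, of x] by auto
  then show ?thesis by (auto simp: kappa_eq order_less_le)
qed

text \<open>The image has fewer than \<open>\<kappa>\<close> points, so by regularity it is not
  cofinal; as there is no largest point, the bound can be made strict.\<close>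

lemma ex_strict_bound:
  fixes f :: "'i \<Rightarrow> 'a"
  assumes "|I| <o \<kappa>"
  shows "\<exists>b. \<forall>i\<in>I. f i < b"
proof -
  have "|f ` I| <o \<kappa>"
    using card_of_image assms by (rule ordLeq_ordLess_trans)
  then have "\<not> cofinal (f ` I) \<kappa>"
    using regular not_ordLess_ordIso by (auto simp: regularCard_def)
  then obtain a where "\<forall>i\<in>I. f i \<le> a"
    by (force simp: cofinal_def kappa_eq)
  moreover obtain b where "a < b" using ex_greater by blast
  ultimately show ?thesis by (meson le_less_trans)
qed

lemma card_atMost: "|{..x::'a}| <o \<kappa>"
proof -
  obtain y where "x < y" using ex_greater by blast
  then have "{..x} \<subseteq> underS \<kappa> y" by (auto simp: underS_def kappa_eq)
  from card_of_mono1[OF this] show ?thesis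
    by (rule ordLeq_ordLess_trans) (simp add: card_of_underS[OF Card_order_kappa])
qed

lemma card_nat: "|UNIV :: nat set| <o \<kappa>"
proof -
  have "\<not> |UNIV :: 'a set| \<le>o |UNIV :: nat set|"
    using unc by (auto simp: countable_def simp flip: card_of_ordLeq)
  then have "|UNIV :: nat set| <o |UNIV :: 'a set|"
    by (rule not_ordLeq_iff_ordLess[OF card_of_Well_order card_of_Well_order, THEN iffD1])
  then show ?thesis
    using card_of_Field_ordIso[OF Card_order_kappa] by (auto intro: ordLess_ordIso_trans)
qed

lemma ex_bound_atMost:
  fixes f :: "'a \<Rightarrow> 'a"
  shows "\<exists>b. \<forall>y\<le>x. f y < b"
  using ex_strict_bound[OF card_atMost, of x f] by auto

lemma ex_successor: "\<exists>t::'a. s < t \<and> (\<forall>u<t. u \<le> s)"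
proof (intro exI conjI allI impI)
  show "s < (LEAST t. s < t)" using ex_greater by (rule LeastI_ex)
  show "u \<le> s" if "u < (LEAST t. s < t)" for u
    using not_less_Least[OF that] by (simp add: not_less)
qed

text \<open>Every point has an immediate successor, which turns the half-open interval into an open
  one.\<close>

lemma open_greaterThanAtMost: "open {b<..s::'a}"
proof -
  obtain t where "s < t" "\<And>u. u < t \<Longrightarrow> u \<le> s" using ex_successor by blast
  then have "{b<..s} = {b<..<t}" by force
  then show ?thesis by simp
qed

section \<open>Closure points and clubs\<close>

text \<open>A point \<open>x < s\<close> with \<open>s \<le> F x\<close>, which keeps
  \<open>s\<close> out, keeps out all of \<open>{x<..s}\<close>. The least point is
  isolated.\<close>

lemma closed_closure_points: "closed (closure_points (F :: 'a \<Rightarrow> 'a))"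
  unfolding closed_def
proof (subst open_subopen, intro ballI)
  fix s assume s: "s \<in> - closure_points F"
  show "\<exists>T. open T \<and> s \<in> T \<and> T \<subseteq> - closure_points F"
  proof (cases "\<exists>x. x < s")
    case False
    obtain t where "s < t" and t: "\<And>u. u < t \<Longrightarrow> u \<le> s" using ex_successor by blast
    have "u = s" if "u < t" for u using t[OF that] False by (meson le_less)
    then have "{..<t} \<subseteq> {s}" by auto
    then show ?thesis using s \<open>s < t\<close> by (intro exI[of _ "{..<t}"]) auto
  next
    case True
    then obtain x where x: "x < s" "s \<le> F x"
      using s by (auto simp: closure_points_def)
    have "{x<..s} \<subseteq> - closure_points F"
      using x by (fastforce dest: closure_pointsD[of _ F x])
    then show ?thesis using x open_greaterThanAtMost by (intro exI[of _ "{x<..s}"]) auto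
  qed
qed

text \<open>The supremum \<open>s\<close> of the countably many iterates of \<open>H\<close> from
  \<open>a\<close> is a closure point: whatever lies below \<open>s\<close> is at most some iterate,
  and \<open>F\<close> sends it below the next one.\<close>

lemma closure_points_unbounded: "\<exists>s\<in>closure_points (F :: 'a \<Rightarrow> 'a). a < s"
proof -
  define H where "H x = (SOME b. \<forall>y\<le>x. max (F y) y < b)" for x
  have H: "F y < H x" "y < H x" if "y \<le> x" for x y
    using someI_ex[OF ex_bound_atMost[of x "\<lambda>y. max (F y) y"]] that by (auto simp: H_def)
  define q where "q n = (H ^^ n) a" for n
  define s where "s = (LEAST b. \<forall>n. q n < b)"
  have "\<exists>b. \<forall>n. q n < b" using ex_strict_bound[OF card_nat, of q] by auto
  then have qs: "q n < s" for n
    unfolding s_def using LeastI_ex[of "\<lambda>b. \<forall>n. q n < b"] by blast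
  have "F y < s" if "y < s" for y
  proof -
    obtain n where "y \<le> q n"
      using not_less_Least[of y "\<lambda>b. \<forall>n. q n < b"] \<open>y < s\<close>
      unfolding s_def by (auto simp: not_less)
    then have "F y < q (Suc n)" using H by (simp add: q_def)
    then show ?thesis using qs less_trans by blast
  qed
  moreover have "a < s" using qs[of 0] by (simp add: q_def)
  ultimately show ?thesis by (auto simp: closure_points_def)
qed

lemma club_closure_points: "club (closure_points (F :: 'a \<Rightarrow> 'a))"
  using closed_closure_points closure_points_unbounded unfolding club_def by (meson less_imp_le)

text \<open>If \<open>F x\<close> is a point of \<open>C\<close> beyond \<open>x\<close>, then every
  closure point of \<open>F\<close> is a limit of \<open>C\<close>.\<close>

lemma club_contains_closure_points:
  assumes "club (C :: 'a set)"
  shows "\<exists>F. closure_points F \<subseteq> C"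
proof -
  have "\<exists>c\<in>C. x < c" for x
    using assms ex_greater[of x] unfolding club_def by (meson less_le_trans)
  then obtain F where F: "\<And>x. F x \<in> C" "\<And>x. x < F x" by metis
  have "s \<in> C" if s: "s \<in> closure_points F" for s
  proof -
    obtain x where "x < s" using s by (auto simp: closure_points_def)
    moreover have "closed C" using assms by (simp add: club_def)
    ultimately show ?thesis
      using closed_limit_point F closure_pointsD[OF s] less_imp_le by metis
  qed
  then show ?thesis by blast
qed

section \<open>Stationary sets and Fodor's lemma\<close>

lemma stationary_iff:
  "stationary (S :: 'a set) \<longleftrightarrow> (\<forall>F. S \<inter> closure_points F \<noteq> {})"
proof
  assume "\<forall>F. S \<inter> closure_points F \<noteq> {}"
  then show "stationary S"
    unfolding stationary_def using club_contains_closure_points by blast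
qed (simp add: stationary_def club_closure_points)

lemma stationaryE:
  assumes "stationary (S :: 'a set)"
  obtains s where "s \<in> S" "s \<in> closure_points F"
  using assms by (force simp: stationary_iff)

lemma not_stationaryE:
  assumes "\<not> stationary (S :: 'a set)"
  obtains F where "S \<inter> closure_points F = {}"
  using assms by (auto simp: stationary_iff)

lemma stationary_Int_closure_points:
  assumes "stationary (S :: 'a set)"
  shows "stationary (S \<inter> closure_points F)"
proof -
  have "S \<inter> closure_points F \<inter> closure_points G \<noteq> {}" for G
    using assms[unfolded stationary_iff, rule_format, of "\<lambda>x. max (F x) (G x)"]
    by (simp add: closure_points_max Int_assoc)
  then show ?thesis by (simp add: stationary_iff)
qed

lemma stationary_unbounded:
  assumes "stationary (S :: 'a set)"
  obtains s where "s \<in> S" "a < s"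
  using stationaryE[OF assms, of "\<lambda>_. a"] by auto

text \<open>Regularity gives a pointwise bound \<open>G\<close> of the functions, and closure under
  \<open>G\<close> implies closure under each of them.\<close>

lemma closure_points_INT:
  fixes F :: "'i \<Rightarrow> 'a \<Rightarrow> 'a"
  assumes "|I| <o \<kappa>"
  shows "\<exists>G. \<forall>i\<in>I. closure_points G \<subseteq> closure_points (F i)"
proof -
  have "\<exists>b. \<forall>i\<in>I. F i x < b" for x
    using ex_strict_bound[OF assms, of "\<lambda>i. F i x"] .
  then obtain G where G: "\<And>x i. i \<in> I \<Longrightarrow> F i x < G x" by metis
  have "F i x < s" if "i \<in> I" "s \<in> closure_points G" "x < s" for i s x
    using G[OF that(1)] closure_pointsD[OF that(2,3)] by (rule less_trans)
  then have "closure_points G \<subseteq> closure_points (F i)" if "i \<in> I" for i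
    using that by (auto simp: closure_points_def)
  then show ?thesis by blast
qed

text \<open>This is the diagonal intersection of clubs. Bounding first over arguments and then over
  indices puts \<open>G x\<close> above all \<open>F z y\<close> with \<open>y \<le> x\<close> and
  \<open>z \<le> x\<close>.\<close>

lemma closure_points_diagonal:
  fixes F :: "'a \<Rightarrow> 'a \<Rightarrow> 'a"
  shows "\<exists>G. \<forall>s\<in>closure_points G. \<forall>x<s. s \<in> closure_points (F x)"
proof -
  have "\<exists>b. \<forall>y\<le>x. F z y < b" for x z
    using ex_bound_atMost by blast
  then obtain B where B: "\<And>x y z. y \<le> x \<Longrightarrow> F z y < B x z" by metis
  have "\<exists>b. \<forall>z\<le>x. B x z < b" for x
    using ex_bound_atMost by blast
  then obtain G where G: "\<And>x z. z \<le> x \<Longrightarrow> B x z < G x" by metis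
  have "F x y < s" if "s \<in> closure_points G" "x < s" "y < s" for s x y
  proof -
    \<comment> \<open>The maximum bounds both the index and the argument and still lies below
      \<open>s\<close>.\<close>
    have "F x y < G (max x y)" using B G less_trans by (meson max.cobounded1 max.cobounded2)
    also have "\<dots> < s" using that by (intro closure_pointsD[of s G]) auto
    finally show ?thesis .
  qed
  then show ?thesis by (intro exI[of _ G]) (auto simp: closure_points_def[of "F _"])
qed

text \<open>Otherwise each fibre over \<open>c\<close> avoids the closure points of some
  \<open>F c\<close>. A point \<open>s\<close> of \<open>S\<close> in their diagonal intersection is
  a closure point of \<open>F (f s)\<close>, since \<open>f s < s\<close>, and lies in the fibre
  over \<open>f s\<close>.\<close>

lemma Fodor:
  assumes "stationary (S :: 'a set)" and regressive: "\<And>s. s \<in> S \<Longrightarrow> f s < s"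
  shows "\<exists>c. stationary {s \<in> S. f s = c}"
proof (rule ccontr)
  assume "\<not> ?thesis"
  then have "\<exists>F. {s \<in> S. f s = c} \<inter> closure_points F = {}" for c
    by (auto simp: stationary_iff)
  then obtain F where F: "\<And>c. {s \<in> S. f s = c} \<inter> closure_points (F c) = {}"
    by metis
  obtain G where G: "\<forall>s\<in>closure_points G. \<forall>x<s. s \<in> closure_points (F x)"
    using closure_points_diagonal by blast
  obtain s where s: "s \<in> S" "s \<in> closure_points G"
    using stationaryE[OF assms(1)] by blast
  then show False using F[of "f s"] G regressive by blast
qed

section \<open>Open sets and short games\<close>

text \<open>A stationary \<open>U\<close> contains an interval of \<open>X\<close> ending at each of
  its non-least points. Fodor's lemma fixes the left end \<open>c\<close> for unboundedly many of
  them, so \<open>U\<close> contains all of \<open>X\<close> beyond \<open>c\<close>.\<close>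

lemma open_dichotomy:
  assumes "stationary (X :: 'a set)" and U: "openin (top_of_set X) U"
  shows "\<exists>F. X \<inter> closure_points F \<subseteq> U \<or> X \<inter> closure_points F \<subseteq> X - U"
proof (cases "stationary U")
  case False
  then obtain F where "U \<inter> closure_points F = {}" by (rule not_stationaryE)
  then show ?thesis by blast
next
  case True
  \<comment> \<open>\<open>closure_points id\<close> consists of all points but the least, which
    leaves no room for a left end.\<close>
  define S where "S = U \<inter> closure_points id"
  obtain O' where O': "open O'" "U = X \<inter> O'" using U by (auto simp: openin_open)
  have "\<exists>b<s. X \<inter> {b<..s} \<subseteq> U" if s: "s \<in> S" for s
  proof -
    obtain x where "x < s" using s by (auto simp: S_def closure_points_def)
    then obtain b where "b < s" "{b<..s} \<subseteq> O'"
      using open_left[of O' s x] s O' by (auto simp: S_def)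
    then show ?thesis using O' by blast
  qed
  then obtain f where f: "\<And>s. s \<in> S \<Longrightarrow> f s < s" "\<And>s. s \<in> S \<Longrightarrow> X \<inter> {f s<..s} \<subseteq> U"
    by metis
  have "stationary S" using True by (simp add: S_def stationary_Int_closure_points)
  then obtain c where c: "stationary {s \<in> S. f s = c}" using Fodor f by blast
  have "X \<inter> closure_points (\<lambda>_. c) \<subseteq> U"
  proof
    fix x assume x: "x \<in> X \<inter> closure_points (\<lambda>_. c)"
    obtain s where "s \<in> S" "f s = c" "x < s"
      using stationary_unbounded[OF c, of x] by blast
    with x f(2)[of s] show "x \<in> U" by fastforce
  qed
  then show ?thesis by blast
qed

lemma short_game_outcome:
  fixes r :: "'b rel" and X :: "'a set"
  assumes "stationary X" "Well_order r" "|Field r| <o \<kappa>"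
    and "seeker_wins r (top_of_set X) P"
  obtains W F where "X \<inter> closure_points F \<subseteq> W" "P W"
proof -
  obtain \<sigma> where \<sigma>: "\<forall>a\<in>Field r. \<forall>u v. openin (top_of_set X) (\<sigma> a u v)"
    and wins: "\<forall>U V. (\<forall>a\<in>Field r. U a = \<sigma> a (restrict U (underS r a)) (restrict V (underS r a)) \<and>
        V a \<in> {U a, X - U a}) \<longrightarrow> P (X \<inter> (\<Inter>a\<in>Field r. V a))"
    using assms(4) unfolding seeker_wins_def topspace_euclidean_subtopology
    by (elim exE conjE) (rule that)
  define large where "large V \<longleftrightarrow> (\<exists>F. X \<inter> closure_points F \<subseteq> V)" for V
  \<comment> \<open>The Hider's reply: if \<open>U\<close> is not large, its complement in
    \<open>X\<close> is, by \<open>open_dichotomy\<close>.\<close>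
  define h where "h U = (if large U then U else X - U)" for U
  \<comment> \<open>A play is recorded as pairs of choices, so that one recursion along
    \<open>r\<close> produces both histories.\<close>
  define move where "move g a = \<sigma> a (restrict (fst \<circ> g) (underS r a)) (restrict (snd \<circ> g) (underS r a))"
    for g :: "'b \<Rightarrow> 'a set \<times> 'a set" and a
  define step where "step g a = (move g a, h (move g a))" for g a
  have wo: "wo_rel r" using assms(2) by (simp add: wo_rel_def)
  define g where "g = wo_rel.worec r step"
  \<comment> \<open>The recursion is admissible because \<open>restrict\<close> hides everything
    from move \<open>a\<close> onwards.\<close>
  have "wo_rel.adm_wo r step"
    unfolding wo_rel.adm_wo_def[OF wo]
  proof (intro allI impI)
    fix f g :: "'b \<Rightarrow> 'a set \<times> 'a set" and a
    assume *: "\<forall>y\<in>underS r a. f y = g y"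
    then have "restrict (fst \<circ> f) (underS r a) = restrict (fst \<circ> g) (underS r a)"
      "restrict (snd \<circ> f) (underS r a) = restrict (snd \<circ> g) (underS r a)"
      by (auto intro: restrict_ext)
    then show "step f a = step g a" by (simp add: step_def move_def)
  qed
  then have "g = step g"
    unfolding g_def by (rule wo_rel.worec_fixpoint[OF wo])
  then have g: "fst (g a) = move g a" "snd (g a) = h (move g a)" for a
    by (metis step_def fst_conv, metis step_def snd_conv)
  have "P (X \<inter> (\<Inter>a\<in>Field r. (snd \<circ> g) a))"
    by (rule wins[THEN spec[of _ "fst \<circ> g"], THEN spec[of _ "snd \<circ> g"], THEN mp])
      (auto simp: g h_def move_def)
  then have P: "P (X \<inter> (\<Inter>a\<in>Field r. snd (g a)))" by simp
  have "large (snd (g a))" if "a \<in> Field r" for a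
  proof -
    have "openin (top_of_set X) (move g a)" using \<sigma> that by (simp add: move_def)
    from open_dichotomy[OF assms(1) this] show ?thesis
      unfolding g h_def large_def by auto
  qed
  then obtain F where F: "\<And>a. a \<in> Field r \<Longrightarrow> X \<inter> closure_points (F a) \<subseteq> snd (g a)"
    unfolding large_def by metis
  obtain G where "\<And>a. a \<in> Field r \<Longrightarrow> closure_points G \<subseteq> closure_points (F a)"
    using closure_points_INT[OF assms(3)] by metis
  then have "X \<inter> closure_points G \<subseteq> X \<inter> (\<Inter>a\<in>Field r. snd (g a))"
    using F by blast
  with P show ?thesis using that by blast
qed

section \<open>Splitting a stationary set\<close>

text \<open>Given \<open>F\<close>, take \<open>E = closure_points F\<close> and the least limit
  \<open>a\<close> of \<open>E\<close> in \<open>X\<close>. As a limit, \<open>a\<close> is itself a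
  closure point of \<open>F\<close>, and no earlier point of \<open>X\<close> is a limit of
  \<open>E\<close>.\<close>

lemma stationary_bounded_traces:
  assumes "stationary (X :: 'a set)"
  shows "stationary {a \<in> X. \<exists>E. (\<forall>x<a. \<exists>e\<in>E. x < e \<and> e < a) \<and>
    (\<forall>b\<in>X. b < a \<longrightarrow> (\<exists>x. x < b) \<longrightarrow> (\<exists>x<b. \<forall>e\<in>E. e < b \<longrightarrow> e \<le> x))}" (is "stationary ?T")
  unfolding stationary_iff
proof
  fix F :: "'a \<Rightarrow> 'a"
  \<comment> \<open>\<open>G\<close> jumps to the next closure point of \<open>F\<close>, so its own
    closure points are the limits of \<open>closure_points F\<close>.\<close>
  define G where "G x = (LEAST c. c \<in> closure_points F \<and> x < c)" for x
  have G: "G x \<in> closure_points F" "x < G x" for x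
    using closure_points_unbounded[of F x] LeastI_ex[of "\<lambda>c. c \<in> closure_points F \<and> x < c"]
    unfolding G_def by blast+
  have G_le: "G x \<le> c" if "c \<in> closure_points F" "x < c" for x c
    unfolding G_def using that by (intro Least_le) auto
  define a where "a = (LEAST a. a \<in> X \<inter> closure_points G)"
  obtain a0 where "a0 \<in> X \<inter> closure_points G"
    using stationaryE[OF assms] by blast
  then have a: "a \<in> X" "a \<in> closure_points G"
    unfolding a_def using LeastI[of "\<lambda>a. a \<in> X \<inter> closure_points G"] by blast+
  have least: "b \<notin> closure_points G" if "b \<in> X" "b < a" for b
    using not_less_Least[of b "\<lambda>a. a \<in> X \<inter> closure_points G"] that by (auto simp: a_def)
  have cofinal: "\<forall>x<a. \<exists>e\<in>closure_points F. x < e \<and> e < a"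
    using G closure_pointsD[OF a(2)] by blast
  have "\<exists>x<b. \<forall>e\<in>closure_points F. e < b \<longrightarrow> e \<le> x" if b: "b \<in> X" "b < a" "\<exists>x. x < b" for b
  proof -
    obtain x where x: "x < b" "b \<le> G x"
      using least[OF b(1,2)] b(3) by (auto simp: closure_points_def[of G])
    then show ?thesis using G_le by (meson leD le_less_trans leI)
  qed
  with a cofinal have "a \<in> ?T" by blast
  moreover have "a \<in> closure_points F"
  proof -
    have "F x < a" if "x < a" for x
      using cofinal that closure_pointsD less_trans by blast
    then show ?thesis using a(2) by (auto simp: closure_points_def)
  qed
  ultimately show "?T \<inter> closure_points F \<noteq> {}" by blast
qed

text \<open>
  If \<open>X\<close> does not split, then for every \<open>x\<close> the next element after \<open>x\<close> of the set \<open>E a\<close> attached to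
  \<open>a\<close> is the same for almost all \<open>a\<close>. Diagonally, \<open>E a\<close> and \<open>E b\<close> agree below \<open>a\<close> for some \<open>a < b\<close>,
  although only the first of them is cofinal in \<open>a\<close>.
\<close>

lemma stationary_splitting:
  assumes "stationary (X :: 'a set)"
  obtains Y where "Y \<subseteq> X" "stationary Y" "stationary (X - Y)"
proof (rule ccontr)
  assume "\<not> thesis"
  then have unsplit: "\<not> stationary (X - Y)" if "Y \<subseteq> X" "stationary Y" for Y
    using that(1,2) \<open>\<And>Y. Y \<subseteq> X \<Longrightarrow> stationary Y \<Longrightarrow> stationary (X - Y) \<Longrightarrow> thesis\<close> by blast
  obtain T E where T: "T \<subseteq> X" "stationary T"
    and cofinal: "\<And>a x. a \<in> T \<Longrightarrow> x < a \<Longrightarrow> \<exists>e\<in>E a. x < e \<and> e < a"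
    and bounded: "\<And>a b. a \<in> T \<Longrightarrow> b \<in> X \<Longrightarrow> b < a \<Longrightarrow> \<exists>x. x < b \<Longrightarrow> \<exists>x<b. \<forall>e\<in>E a. e < b \<longrightarrow> e \<le> x"
  proof -
    let ?good = "\<lambda>a E. (\<forall>x<a. \<exists>e\<in>E. x < e \<and> e < a) \<and>
      (\<forall>b\<in>X. b < a \<longrightarrow> (\<exists>x. x < b) \<longrightarrow> (\<exists>x<b. \<forall>e\<in>E. e < b \<longrightarrow> e \<le> x))"
    have good: "?good a (SOME E. ?good a E)" if "a \<in> {a \<in> X. \<exists>E. ?good a E}" for a
      by (rule someI_ex) (use that in blast)
    show ?thesis
      by (rule that[of "{a \<in> X. \<exists>E. ?good a E}" "\<lambda>a. SOME E. ?good a E"])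
        (use stationary_bounded_traces[OF assms] good in blast)+
  qed
  define f where "f x a = (LEAST e. e \<in> E a \<and> x < e)" for x a
  have f: "f x a \<in> E a" "x < f x a" "f x a < a" if a: "a \<in> T" "x < a" for x a
  proof -
    obtain e where e: "e \<in> E a" "x < e" "e < a" using cofinal[OF a] by blast
    then show "f x a \<in> E a" "x < f x a"
      unfolding f_def using LeastI[of "\<lambda>e. e \<in> E a \<and> x < e" e] by blast+
    have "f x a \<le> e" unfolding f_def using e by (intro Least_le) auto
    then show "f x a < a" using e by simp
  qed
  \<comment> \<open>Fodor's lemma makes \<open>f x\<close> constant on a stationary part of
    \<open>T\<close>; as \<open>X\<close> does not split, the rest of \<open>X\<close> misses a
    club.\<close>
  have "\<exists>c F. \<forall>a \<in> T \<inter> closure_points F. f x a = c" for x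
  proof -
    \<comment> \<open>Beyond \<open>x\<close> the function \<open>f x\<close> is regressive.\<close>
    define S where "S = T \<inter> closure_points (\<lambda>_. x)"
    have "stationary S" using T(2) unfolding S_def by (rule stationary_Int_closure_points)
    moreover have "f x a < a" if "a \<in> S" for a using that f(3) by (auto simp: S_def)
    ultimately obtain c where c: "stationary {a \<in> S. f x a = c}" using Fodor by blast
    have "{a \<in> S. f x a = c} \<subseteq> X" using T by (auto simp: S_def)
    then obtain F where "(X - {a \<in> S. f x a = c}) \<inter> closure_points F = {}"
      using unsplit c not_stationaryE by metis
    then have "f x a = c" if "a \<in> T" "a \<in> closure_points F" for a
      using that T(1) by blast
    then show ?thesis by blast
  qed
  then obtain c F where F: "\<And>x a. a \<in> T \<Longrightarrow> a \<in> closure_points (F x) \<Longrightarrow> f x a = c x"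
    by (metis IntI)
  obtain G where G: "\<And>s x. s \<in> closure_points G \<Longrightarrow> x < s \<Longrightarrow> s \<in> closure_points (F x)"
    using closure_points_diagonal[of F] by blast
  have stat: "stationary (T \<inter> closure_points G)"
    using T(2) by (rule stationary_Int_closure_points)
  obtain a where a: "a \<in> T" "a \<in> closure_points G" using stationaryE[OF T(2)] by blast
  obtain b where b: "b \<in> T" "b \<in> closure_points G" "a < b"
    using stationary_unbounded[OF stat, of a] by blast
  have "\<exists>x. x < a" using a(2) by (auto simp: closure_points_def)
  then obtain x where x: "x < a" "\<And>e. e \<in> E b \<Longrightarrow> e < a \<Longrightarrow> e \<le> x"
    using bounded[of b a] a b T(1) by blast
  have "x < b" using x b by simp
  have "f x b = f x a" using F G a b x(1) \<open>x < b\<close> by metis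
  \<comment> \<open>Being equal to \<open>f x a\<close>, the point \<open>f x b\<close> lies below
    \<open>a\<close>; as an element of \<open>E b\<close> below \<open>a\<close> it is at most
    \<open>x\<close>, although it was chosen beyond \<open>x\<close>.\<close>
  then have "f x b \<le> x" using x f(1)[OF b(1) \<open>x < b\<close>] f(3)[OF a(1) x(1)] by simp
  with f(2)[OF b(1) \<open>x < b\<close>] show False by simp
qed

section \<open>Winning in \<open>\<kappa>\<close> moves\<close>

text \<open>If \<open>x < y\<close>, the ray played at move \<open>x\<close> contains
  \<open>y\<close> but not \<open>x\<close>, so either reply of the Hider discards one of
  them.\<close>

lemma kappa_wins_point_separating: "wins_point_separating \<kappa> (top_of_set (X :: 'a set))"
  unfolding wins_point_separating_def seeker_wins_def
proof (intro exI[of _ "\<lambda>a _ _. X \<inter> {a<..}"] conjI allI impI ballI)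
  fix a :: 'a and u v :: "'a \<Rightarrow> 'a set"
  show "openin (top_of_set X) (X \<inter> {a<..})"
    by (simp add: openin_open_Int)
next
  fix U V :: "'a \<Rightarrow> 'a set"
  assume UV: "\<forall>a\<in>Field \<kappa>. U a = X \<inter> {a<..} \<and> V a \<in> {U a, topspace (top_of_set X) - U a}"
  let ?W = "topspace (top_of_set X) \<inter> (\<Inter>a\<in>Field \<kappa>. V a)"
  have "\<not> x < y" if "x \<in> ?W" "y \<in> ?W" for x y
  proof
    assume "x < y"
    then show False using that UV[rule_format, of x] by auto
  qed
  then have "?W \<subseteq> {x}" if "x \<in> ?W" for x
    using that by (metis linorder_neqE singletonI subsetI)
  then have "?W = {} \<or> (\<exists>x. ?W = {x})" by blast
  then show "finite ?W" "card ?W \<le> 1" by (elim disjE exE; simp)+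
qed

lemma kappa_wins_set_membership: "wins_set_membership \<kappa> Y (top_of_set (X :: 'a set))"
proof -
  have "W \<subseteq> Y \<or> W \<inter> Y = {}" if "finite W" "card W \<le> 1" for W :: "'a set"
    using that by (auto simp: card_le_Suc0_iff_eq)
  then show ?thesis
    unfolding wins_set_membership_def
    by (intro seeker_wins_mono[OF kappa_wins_point_separating[unfolded wins_point_separating_def]]) auto
qed

text \<open>A strictly shorter \<open>r\<close> would give \<open>|Field r| \<le>o r\<close> and
  \<open>r <o \<kappa>\<close>. This passes from the cardinality of the set of moves to the length
  of the game.\<close>

lemma ordIso_kappaI:
  assumes "Well_order r" "r \<le>o \<kappa>" "\<not> |Field r| <o \<kappa>"
  shows "(r, \<kappa>) \<in> ordIso"
proof -
  have "|Field r| \<le>o r" using assms(1) by (simp add: card_of_least)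
  then show ?thesis
    using assms(2,3) ordLeq_ordLess_trans unfolding ordLeq_iff_ordLess_or_ordIso[of r] by metis
qed

end

section \<open>The values of the two invariants\<close>

theorem theorem4p11:
  fixes \<kappa> :: "'a::{wellorder,linorder_topology} rel"
    and X :: "'a set"
  assumes "\<kappa> = {(x, y). x \<le> y}"
    and "card_order \<kappa>" and "regularCard \<kappa>" and "uncountable (UNIV :: 'a set)"
    and "stationary X"
  shows "ps (top_of_set X) =o \<kappa> \<and> sm (top_of_set X) =o \<kappa>"
proof
  interpret regular_uncountable \<kappa>
    using assms by unfold_locales auto
  let ?X = "top_of_set X"
  note ps = least_ordinal[of \<kappa> "\<lambda>r. wins_point_separating r ?X", folded ps_def,
      OF Well_order_kappa kappa_wins_point_separating]
  have "\<not> |Field (ps ?X)| <o \<kappa>"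
  proof
    assume short: "|Field (ps ?X)| <o \<kappa>"
    obtain W F where W: "X \<inter> closure_points F \<subseteq> W" "finite W \<and> card W \<le> 1"
      by (rule short_game_outcome[OF assms(5) ps(1) short ps(2)[unfolded wins_point_separating_def]])
    \<comment> \<open>The outcome of a short game contains a stationary set, hence two distinct
      points.\<close>
    have stat: "stationary (X \<inter> closure_points F)"
      using assms(5) by (rule stationary_Int_closure_points)
    obtain x where "x \<in> X \<inter> closure_points F" using stationary_unbounded[OF stat] by blast
    moreover obtain y where "y \<in> X \<inter> closure_points F" "x < y"
      using stationary_unbounded[OF stat] by blast
    ultimately have "x \<in> W" "y \<in> W" "x < y" using W(1) by blast+
    then show False using W(2) by (metis card_le_Suc0_iff_eq One_nat_def less_irrefl)
  qed
  then show "ps ?X =o \<kappa>"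
    using ps(1) ps(3)[OF Well_order_kappa kappa_wins_point_separating] by (intro ordIso_kappaI)
  note sm_set = least_ordinal[of \<kappa> "\<lambda>r. wins_set_membership r Y ?X" for Y, folded sm_set_def,
      OF Well_order_kappa kappa_wins_set_membership]
  have kappa: "\<forall>Y\<subseteq>topspace ?X. sm_set Y ?X \<le>o \<kappa>"
    using sm_set(3)[OF Well_order_kappa kappa_wins_set_membership] by blast
  note sm = least_ordinal[of \<kappa> "\<lambda>r. \<forall>Y\<subseteq>topspace ?X. sm_set Y ?X \<le>o r", folded sm_def,
      OF Well_order_kappa kappa]
  \<comment> \<open>Every outcome containing the trace of a club meets both \<open>Y\<close> and
    \<open>X - Y\<close>, so this single \<open>Y\<close> already pushes the supremum up to
    \<open>\<kappa>\<close>.\<close>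
  obtain Y where Y: "Y \<subseteq> X" "stationary Y" "stationary (X - Y)"
    using stationary_splitting[OF assms(5)] by blast
  have "\<not> |Field (sm_set Y ?X)| <o \<kappa>"
  proof
    assume short: "|Field (sm_set Y ?X)| <o \<kappa>"
    obtain W F where W: "X \<inter> closure_points F \<subseteq> W" "W \<subseteq> Y \<or> W \<inter> Y = {}"
      by (rule short_game_outcome[OF assms(5) sm_set(1) short sm_set(2)[unfolded wins_set_membership_def]])
    obtain x where "x \<in> Y" "x \<in> closure_points F" using stationaryE[OF Y(2)] by blast
    moreover obtain y where "y \<in> X - Y" "y \<in> closure_points F" using stationaryE[OF Y(3)] by blast
    ultimately show False using W Y(1) by blast
  qed
  then have "sm_set Y ?X =o \<kappa>"
    using sm_set(1) kappa Y(1) by (intro ordIso_kappaI) auto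
  moreover have "sm_set Y ?X \<le>o sm ?X" using sm(2) Y(1) by simp
  ultimately have "\<kappa> \<le>o sm ?X" using ordIso_symmetric ordIso_ordLeq_trans by blast
  then show "sm ?X =o \<kappa>" using sm(3)[OF Well_order_kappa kappa] by (simp add: ordIso_iff_ordLeq)
qed

end
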